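(* Let $K$ be a field, $S=K[x_1,\dots,x_n]$, and let $I\subset S$ be a squarefree monomial ideal. Then $I$ is matroidal if and only if its complementary ideal $I_c(I)$ is matroidal.
   Context: For a monomial ideal $I\subset S$, $\mathcal{G}(I)$ denotes its unique minimal set of monomial generators. For a non-zero squarefree monomial ideal $I\subset S=K[x_1,\dots,x_n]$, the complementary ideal of $I$ is $I_c(I)=\big((x_1\cdots x_n)/u \,:\, u\in\mathcal{G}(I)\big)$; if $I=(0)$ one sets $I_c(I)=(0)$. For a monomial $u$, $\deg_{x_i}(u)=\max\{j : x_i^j \text{ divides } u\}$. A monomial ideal $I$ is polymatroidal if all monomials in $\mathcal{G}(I)$ have the same degree and the exchange property holds: for all $u,v\in\mathcal{G}(I)$ and all $i$ with $\deg_{x_i}(u)>\deg_{x_i}(v)$, there exists $j$ with $\deg_{x_j}(u)<\deg_{x_j}(v)$ such that $x_j(u/x_i)\in\mathcal{G}(I)$. A matroidal ideal is a squarefree polymatroidal ideal. *)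

theory Defs
  imports Complex_Main "HOL-Library.Poly_Mapping"
begin

(* The polynomial ring K[x_1,...,x_n]: the finite index type 'n plays the role of {1,...,n},
   and a polynomial is a finitely supported map from exponent vectors to coefficients. *)
type_synonym ('n, 'k) mpoly = "('n \<Rightarrow>\<^sub>0 nat) \<Rightarrow>\<^sub>0 'k"

definition monomial :: "('n \<Rightarrow>\<^sub>0 nat) \<Rightarrow> ('n, 'k::field) mpoly" where
  "monomial t = Poly_Mapping.single t 1"

definition var :: "'n \<Rightarrow> ('n, 'k::field) mpoly" where
  "var i = monomial (Poly_Mapping.single i 1)"

interpretation ideal: module "(*) :: ('n, 'k::field) mpoly \<Rightarrow> _"
  by unfold_locales (simp_all add: algebra_simps)

(* An ideal is a submodule of the ring over itself, so the ideal generated by M is the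
   span of M in that module. *)
definition ideal_gen :: "('n, 'k::field) mpoly set \<Rightarrow> ('n, 'k) mpoly set" where
  "ideal_gen M = ideal.span M"

definition monomial_ideal :: "('n, 'k::field) mpoly set \<Rightarrow> bool" where
  "monomial_ideal I \<longleftrightarrow> (\<exists>M \<subseteq> range monomial. I = ideal_gen M)"

definition deg_var :: "'n \<Rightarrow> ('n, 'k::field) mpoly \<Rightarrow> nat" where
  "deg_var i u = Max {j. var i ^ j dvd u}"

(* The total degree; only meaningful for a monomial u, like deg_var. *)
definition mdegree :: "('n::finite, 'k::field) mpoly \<Rightarrow> nat" where
  "mdegree u = (\<Sum>i\<in>UNIV. deg_var i u)"

definition squarefree_monomial :: "('n, 'k::field) mpoly \<Rightarrow> bool" where
  "squarefree_monomial u \<longleftrightarrow> u \<in> range monomial \<and> (\<forall>i. deg_var i u \<le> 1)"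

definition squarefree_monomial_ideal :: "('n, 'k::field) mpoly set \<Rightarrow> bool" where
  "squarefree_monomial_ideal I \<longleftrightarrow> (\<exists>M \<subseteq> Collect squarefree_monomial. I = ideal_gen M)"

definition is_min_mono_gens :: "('n, 'k::field) mpoly set \<Rightarrow> ('n, 'k) mpoly set \<Rightarrow> bool" where
  "is_min_mono_gens G I \<longleftrightarrow>
     G \<subseteq> range monomial \<and> ideal_gen G = I \<and> (\<forall>H. H \<subset> G \<longrightarrow> ideal_gen H \<noteq> I)"

(* Only meaningful for monomial ideals, where existence and uniqueness hold
   (lemma ex1_min_mono_gens below). *)
definition min_mono_gens :: "('n, 'k::field) mpoly set \<Rightarrow> ('n, 'k) mpoly set" where
  "min_mono_gens I = (THE G. is_min_mono_gens G I)"

(* The quotient (x_1 ... x_n)/u is the polynomial w with u * w = x_1 ... x_n; it is unique because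
   the monomial u is not a zero divisor, and it exists for squarefree u. *)
definition complementary_ideal :: "('n::finite, 'k::field) mpoly set \<Rightarrow> ('n, 'k) mpoly set" where
  "complementary_ideal I =
     (if I = {0} then {0}
      else ideal_gen {w. \<exists>u\<in>min_mono_gens I. u * w = (\<Prod>i\<in>UNIV. var i)})"

(* In the exchange property w is u/x_i. *)
definition polymatroidal :: "('n::finite, 'k::field) mpoly set \<Rightarrow> bool" where
  "polymatroidal I \<longleftrightarrow>
     monomial_ideal I \<and>
     (\<forall>u\<in>min_mono_gens I. \<forall>v\<in>min_mono_gens I. mdegree u = mdegree v) \<and>
     (\<forall>u\<in>min_mono_gens I. \<forall>v\<in>min_mono_gens I. \<forall>i. deg_var i u > deg_var i v \<longrightarrow>
        (\<exists>j. deg_var j u < deg_var j v \<and>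
             (\<exists>w. u = var i * w \<and> var j * w \<in> min_mono_gens I)))"

definition matroidal :: "('n::finite, 'k::field) mpoly set \<Rightarrow> bool" where
  "matroidal I \<longleftrightarrow> squarefree_monomial_ideal I \<and> polymatroidal I"

lemma monomial_dvd_iff:
  "(monomial s :: ('n, 'k::field) mpoly) dvd monomial t \<longleftrightarrow> (\<exists>c. t = s + c)"
proof
  assume "(monomial s :: ('n, 'k) mpoly) dvd monomial t"
  then obtain p :: "('n, 'k) mpoly" where p: "monomial t = monomial s * p"
    by (auto simp: dvd_def)
  have "t \<in> Poly_Mapping.keys (monomial t :: ('n, 'k) mpoly)"
    by (simp add: monomial_def)
  also have "\<dots> = Poly_Mapping.keys (monomial s * p)"
    by (simp add: p)
  also have "\<dots> \<subseteq> {a + b | a b. a \<in> Poly_Mapping.keys (monomial s :: ('n, 'k) mpoly) \<and> b \<in> Poly_Mapping.keys p}"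
    by (rule keys_mult)
  finally show "\<exists>c. t = s + c"
    by (auto simp: monomial_def)
next
  assume "\<exists>c. t = s + c"
  then obtain c where "t = s + c" by blast
  then have "(monomial t :: ('n, 'k) mpoly) = monomial s * monomial c"
    by (simp add: monomial_def Poly_Mapping.mult_single)
  then show "(monomial s :: ('n, 'k) mpoly) dvd monomial t" by simp
qed

lemma deg_var_monomial:
  "deg_var i (monomial t :: ('n, 'k::field) mpoly) = Poly_Mapping.lookup t i"
proof -
  have pow: "(var i :: ('n, 'k) mpoly) ^ j = monomial (Poly_Mapping.single i j)" for j
    by (induction j)
       (simp_all add: var_def monomial_def Poly_Mapping.mult_single
          single_add[symmetric] flip: single_one)
  have "(\<exists>c. t = Poly_Mapping.single i j + c) \<longleftrightarrow> j \<le> Poly_Mapping.lookup t i" for j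
  proof
    assume "\<exists>c. t = Poly_Mapping.single i j + c"
    then show "j \<le> Poly_Mapping.lookup t i"
      by (auto simp: Poly_Mapping.lookup_add)
  next
    assume "j \<le> Poly_Mapping.lookup t i"
    then have "t = Poly_Mapping.single i j + (t - Poly_Mapping.single i j)"
      by (intro poly_mapping_eqI)
         (auto simp: Poly_Mapping.lookup_add Poly_Mapping.lookup_minus
            Poly_Mapping.lookup_single when_def)
    then show "\<exists>c. t = Poly_Mapping.single i j + c" ..
  qed
  then have "{j. var i ^ j dvd (monomial t :: ('n, 'k) mpoly)} = {..Poly_Mapping.lookup t i}"
    unfolding pow monomial_dvd_iff by auto
  then show ?thesis
    by (simp add: deg_var_def Max_eq_iff)
qed

lemma monomial_in_ideal_gen_iff:
  fixes M :: "('n, 'k::field) mpoly set"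
  assumes M: "M \<subseteq> range monomial"
  shows "monomial t \<in> ideal_gen M \<longleftrightarrow> (\<exists>m\<in>M. m dvd monomial t)"
proof
  let ?T = "{t. \<exists>m\<in>M. m dvd (monomial t :: ('n, 'k) mpoly)}"
  have up: "c + s \<in> ?T" if "s \<in> ?T" for c s
  proof -
    have "(monomial (c + s) :: ('n, 'k) mpoly) = monomial c * monomial s"
      by (simp add: monomial_def Poly_Mapping.mult_single)
    with that show ?thesis by (auto intro: dvd_mult)
  qed
  have sub: "ideal.subspace {f :: ('n, 'k) mpoly. Poly_Mapping.keys f \<subseteq> ?T}"
  proof (rule ideal.subspaceI)
    show "0 \<in> {f :: ('n, 'k) mpoly. Poly_Mapping.keys f \<subseteq> ?T}" by simp
  next
    fix x y :: "('n, 'k) mpoly"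
    assume "x \<in> {f. Poly_Mapping.keys f \<subseteq> ?T}" "y \<in> {f. Poly_Mapping.keys f \<subseteq> ?T}"
    then show "x + y \<in> {f. Poly_Mapping.keys f \<subseteq> ?T}"
      using keys_add[of x y] by blast
  next
    fix c x :: "('n, 'k) mpoly"
    assume x: "x \<in> {f. Poly_Mapping.keys f \<subseteq> ?T}"
    have "t \<in> ?T" if t: "t \<in> Poly_Mapping.keys (c * x)" for t
    proof -
      from subsetD[OF keys_mult t] obtain a b where "t = a + b" "b \<in> Poly_Mapping.keys x"
        by blast
      moreover from this x have "b \<in> ?T" by blast
      ultimately show ?thesis using up by (simp only:)
    qed
    then show "c * x \<in> {f. Poly_Mapping.keys f \<subseteq> ?T}" by blast
  qed
  have "M \<subseteq> {f. Poly_Mapping.keys f \<subseteq> ?T}"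
  proof
    fix m assume m: "m \<in> M"
    then obtain t where t: "m = monomial t" using M by blast
    have "t \<in> ?T" using m dvd_refl unfolding t by blast
    then show "m \<in> {f. Poly_Mapping.keys f \<subseteq> ?T}"
      unfolding t by (simp add: monomial_def)
  qed
  from ideal.span_minimal[OF this sub] have *: "ideal_gen M \<subseteq> {f. Poly_Mapping.keys f \<subseteq> ?T}"
    by (simp add: ideal_gen_def)
  show "\<exists>m\<in>M. m dvd monomial t" if "monomial t \<in> ideal_gen M"
  proof -
    have "t \<in> Poly_Mapping.keys (monomial t :: ('n, 'k) mpoly)"
      by (simp add: monomial_def)
    with subsetD[OF * that] show ?thesis by blast
  qed
  show "monomial t \<in> ideal_gen M" if "\<exists>m\<in>M. m dvd monomial t"
  proof -
    from that obtain m p where m: "m \<in> M" and p: "monomial t = m * p"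
      unfolding dvd_def by blast
    show ?thesis
      unfolding ideal_gen_def p mult.commute[of m p]
      by (rule ideal.span_scale[OF ideal.span_base[OF m]])
  qed
qed

lemma ex1_min_mono_gens:
  fixes I :: "('n::finite, 'k::field) mpoly set"
  assumes "monomial_ideal I"
  shows "\<exists>!G. is_min_mono_gens G I"
proof -
  from assms obtain M where M: "M \<subseteq> range monomial" and I: "I = ideal_gen M"
    by (auto simp: monomial_ideal_def)
  define E where "E = {t. (monomial t :: ('n, 'k) mpoly) \<in> I}"
  define B where "B = {t \<in> E. \<forall>s\<in>E. \<forall>c. t = s + c \<longrightarrow> s = t}"
  define G :: "('n, 'k) mpoly set" where "G = monomial ` B"
  have gen: "\<exists>s\<in>B. \<exists>c. t = s + c" if "t \<in> E" for t
    using that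
  proof (induction "\<Sum>i\<in>UNIV. Poly_Mapping.lookup t i" arbitrary: t rule: less_induct)
    case less
    show ?case
    proof (cases "t \<in> B")
      case True
      moreover have "t = t + 0" by simp
      ultimately show ?thesis by blast
    next
      case False
      then obtain s c where s: "s \<in> E" "t = s + c" "s \<noteq> t"
        using less.prems unfolding B_def by blast
      then have "c \<noteq> 0" by auto
      then obtain k where "Poly_Mapping.lookup c k \<noteq> 0"
        using poly_mapping_eqI[of c 0] by auto
      then have "(\<Sum>i\<in>UNIV. Poly_Mapping.lookup s i) < (\<Sum>i\<in>UNIV. Poly_Mapping.lookup t i)"
        unfolding s(2) Poly_Mapping.lookup_add by (intro sum_strict_mono_ex1) auto
      from less.hyps[OF this s(1)] obtain b d where "b \<in> B" "s = b + d" by blast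
      moreover from this s(2) have "t = b + (d + c)" by (simp only: add.assoc)
      ultimately show ?thesis by blast
    qed
  qed
  have G_sub: "G \<subseteq> H" if H: "H \<subseteq> range monomial" "ideal_gen H = I" for H
  proof
    fix g assume "g \<in> G"
    then obtain t where t: "t \<in> B" "g = monomial t" by (auto simp: G_def)
    then have "monomial t \<in> ideal_gen H" using H by (auto simp: B_def E_def)
    then obtain h where h: "h \<in> H" "h dvd monomial t"
      using monomial_in_ideal_gen_iff[OF H(1)] by blast
    then obtain s where s: "h = monomial s" using H by blast
    have "s \<in> E" using h s H(2) by (auto simp: E_def ideal_gen_def ideal.span_base)
    moreover obtain c where "t = s + c" using h s monomial_dvd_iff by blast
    ultimately have "s = t" using t unfolding B_def by blast
    then show "g \<in> H" using h s t by simp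
  qed
  have G_range: "G \<subseteq> range monomial" by (auto simp: G_def)
  have G_gen: "ideal_gen G = I"
  proof
    have "G \<subseteq> I" by (auto simp: G_def B_def E_def)
    then show "ideal_gen G \<subseteq> I"
      unfolding I ideal_gen_def by (simp add: ideal.span_minimal)
    have "M \<subseteq> ideal_gen G"
    proof
      fix m assume m: "m \<in> M"
      then obtain t where t: "m = monomial t" using M by blast
      then have "t \<in> E" using m by (simp add: E_def I ideal_gen_def ideal.span_base)
      from gen[OF this] obtain s c where s: "s \<in> B" "t = s + c" by blast
      then have "(monomial s :: ('n, 'k) mpoly) dvd monomial t"
        using monomial_dvd_iff by blast
      with s show "m \<in> ideal_gen G"
        unfolding t monomial_in_ideal_gen_iff[OF G_range] by (auto simp: G_def)
    qed
    then show "I \<subseteq> ideal_gen G"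
      unfolding I ideal_gen_def by (simp add: ideal.span_minimal)
  qed
  show ?thesis
  proof (rule ex1I[of _ G])
    show "is_min_mono_gens G I"
      unfolding is_min_mono_gens_def using G_range G_gen G_sub by blast
    show "H = G" if "is_min_mono_gens H I" for H
      using that G_sub[of H] G_gen unfolding is_min_mono_gens_def by blast
  qed
qed

end

theory Submission
  imports Defs
begin

text \<open>
  A squarefree monomial \<open>\<Prod>i\<in>A. x\<^sub>i\<close> is the same thing as its support \<open>A\<close>, and for such monomials
  divisibility is inclusion of supports. A squarefree monomial ideal is therefore the same thing as
  an antichain \<open>F\<close> of subsets of the variables, the supports of its minimal generators. Under this
  dictionary the ideal is matroidal iff \<open>F\<close> is the family of bases of a matroid, or is empty
  (\<open>matroidal_ideal_of_iff\<close>). Dividing \<open>x\<^sub>1 \<cdots> x\<^sub>n\<close> by a generator complements its support, and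
  complements of an antichain again form an antichain, so the complementary ideal corresponds to
  \<open>uminus ` F\<close> (\<open>complementary_ideal_ideal_of\<close>). The theorem thus says that the complements of the
  bases of a matroid are the bases of a matroid, the dual one. As complementation is an involution,
  one implication suffices.

  Its content is \<open>base_family_dual_exchange\<close>. Exchange in the complements says that an
  element \<open>i\<close> of a basis \<open>B\<close> can be brought into a basis \<open>A\<close> at the cost of some \<open>j\<close> in \<open>A - B\<close>,
  whereas the axiom prescribes which element leaves and leaves open which one enters. The two are
  reconciled by moving \<open>B\<close> towards \<open>A\<close> through exchanges that never discard \<open>i\<close>.
\<close>

section \<open>Bases of matroids and their complements\<close>

text \<open>The empty family is admitted because it corresponds to the zero ideal, which counts as
  matroidal.\<close>

definition base_family :: "'a set set \<Rightarrow> bool" where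
  "base_family F \<longleftrightarrow>
     (\<forall>A\<in>F. \<forall>B\<in>F. card A = card B) \<and>
     (\<forall>A\<in>F. \<forall>B\<in>F. \<forall>i\<in>A - B. \<exists>j\<in>B - A. insert j (A - {i}) \<in> F)"

lemma base_family_card_eq:
  assumes "base_family F" "A \<in> F" "B \<in> F"
  shows "card A = card B"
  by (rule bspec[OF bspec[OF conjunct1[OF assms(1)[unfolded base_family_def]] assms(2)] assms(3)])

lemma base_family_exchangeE:
  assumes "base_family F" "A \<in> F" "B \<in> F" "i \<in> A - B"
  obtains j where "j \<in> B - A" "insert j (A - {i}) \<in> F"
  using bspec[OF bspec[OF bspec[OF conjunct2[OF assms(1)[unfolded base_family_def]] assms(2)]
    assms(3)] assms(4)] that by (elim bexE)

text \<open>Among the bases that contain \<open>i\<close> and \<open>A \<inter> B\<close>, one that is closest to \<open>A\<close> has only \<open>i\<close> outside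
  \<open>A\<close>: any other element outside \<open>A\<close> could be exchanged for one of \<open>A\<close>. By equal cardinality it
  misses exactly one element \<open>j\<close> of \<open>A\<close>, and \<open>j\<close> is not in \<open>B\<close> because \<open>A \<inter> B\<close> was kept.\<close>

lemma base_family_dual_exchange:
  fixes F :: "'a::finite set set"
  assumes F: "base_family F" and A: "A \<in> F" and B: "B \<in> F" and i: "i \<in> B - A"
  shows "\<exists>j\<in>A - B. insert i (A - {j}) \<in> F"
proof -
  define P where "P C \<longleftrightarrow> C \<in> F \<and> i \<in> C \<and> A \<inter> B \<subseteq> C" for C
  have "P B" using B i by (auto simp: P_def)
  then obtain C where C: "P C" and min: "\<And>D. P D \<Longrightarrow> card (C - A) \<le> card (D - A)"
    using ex_has_least_nat[of P B "\<lambda>C. card (C - A)"] by blast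
  have CF: "C \<in> F" and iC: "i \<in> C" and AB: "A \<inter> B \<subseteq> C" using C by (auto simp: P_def)
  have CA: "C - A = {i}"
  proof (rule ccontr)
    assume "C - A \<noteq> {i}"
    then obtain k where k: "k \<in> C - A" "k \<noteq> i" using i iC by blast
    obtain l where l: "l \<in> A - C" "insert l (C - {k}) \<in> F"
      using base_family_exchangeE[OF F CF A k(1)] .
    have "P (insert l (C - {k}))" using l k iC AB by (auto simp: P_def)
    from min[OF this] have "card (C - A) \<le> card (insert l (C - {k}) - A)" .
    also have "insert l (C - {k}) - A = C - A - {k}" using l by blast
    also have "card (C - A - {k}) < card (C - A)" using k by (intro card_Diff1_less) auto
    finally show False by simp
  qed
  have "card C = card A" using base_family_card_eq[OF F CF A] .
  moreover have "card C = card (C \<inter> A) + card (C - A)" "card A = card (A \<inter> C) + card (A - C)"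
    by (rule card_Int_Diff, simp)+
  ultimately have "card (A - C) = 1" using CA by (simp add: Int_commute)
  then obtain j where j: "A - C = {j}" by (auto simp: card_1_singleton_iff)
  have "insert i (A - {j}) = C" using CA j by auto
  moreover have "j \<in> A - B" using j AB by blast
  ultimately show ?thesis using CF by blast
qed

lemma base_family_complements:
  fixes F :: "'a::finite set set"
  assumes F: "base_family F"
  shows "base_family (uminus ` F)"
  unfolding base_family_def
proof (intro conjI ballI; (elim imageE; hypsubst)?)
  fix A B assume "A \<in> F" "B \<in> F"
  then have "card A = card B" by (rule base_family_card_eq[OF F])
  then show "card (- A) = card (- B)"
    unfolding Compl_eq_Diff_UNIV by (subst (1 2) card_Diff_subset) auto
next
  fix i A B assume *: "i \<in> - A - - B" "A \<in> F" "B \<in> F"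
  then have "i \<in> B - A" by blast
  from base_family_dual_exchange[OF F *(2,3) this]
  obtain j where j: "j \<in> A - B" "insert i (A - {j}) \<in> F" by blast
  have "insert j (- A - {i}) = - insert i (A - {j})" using j(1) *(1) by auto
  then have "insert j (- A - {i}) \<in> uminus ` F" using j(2) by simp
  then show "\<exists>j\<in>- B - - A. insert j (- A - {i}) \<in> uminus ` F" using j(1) by auto
qed

lemma base_family_complements_iff:
  fixes F :: "'a::finite set set"
  shows "base_family (uminus ` F) \<longleftrightarrow> base_family F"
  using base_family_complements[of F] base_family_complements[of "uminus ` F"]
  by (auto simp: image_image)

section \<open>Minimal monomial generators\<close>

lemma monomial_dvd_monomial_iff:
  "(monomial s :: ('n, 'k::field) mpoly) dvd monomial t \<longleftrightarrow>
     (\<forall>i. Poly_Mapping.lookup s i \<le> Poly_Mapping.lookup t i)"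
proof
  assume "\<forall>i. Poly_Mapping.lookup s i \<le> Poly_Mapping.lookup t i"
  then have "t = s + (t - s)"
    by (intro poly_mapping_eqI) (simp add: lookup_add lookup_minus)
  then show "(monomial s :: ('n, 'k) mpoly) dvd monomial t"
    unfolding monomial_dvd_iff ..
qed (auto simp: monomial_dvd_iff lookup_add)

lemma monomial_dvd_antisym:
  assumes "u \<in> range monomial" "v \<in> range monomial" "u dvd v" "v dvd u"
  shows "u = (v :: ('n, 'k::field) mpoly)"
proof -
  obtain s t where st: "u = monomial s" "v = monomial t" using assms by blast
  have "s = t"
    using assms(3,4) unfolding st monomial_dvd_monomial_iff
    by (intro poly_mapping_eqI) (simp add: order_antisym)
  then show ?thesis using st by simp
qed

text \<open>Multiplication by a monomial only shifts coefficients, so it is injective and quotients by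
  monomials are unique.\<close>

lemma lookup_monomial_mult:
  "Poly_Mapping.lookup ((monomial s :: ('n, 'k::field) mpoly) * p) (s + t) = Poly_Mapping.lookup p t"
proof (induction p rule: update_induct)
  case const
  show ?case by simp
next
  case (update p k c)
  then have "Poly_Mapping.update k c p = p + Poly_Mapping.single k c"
    by (intro poly_mapping_eqI)
      (auto simp: lookup_update lookup_add lookup_single when_def in_keys_iff)
  moreover have "monomial s * Poly_Mapping.single k c = Poly_Mapping.single (s + k) c"
    by (simp add: monomial_def Poly_Mapping.mult_single)
  ultimately show ?case
    by (simp add: distrib_left lookup_add update.IH lookup_single when_def)
qed

lemma monomial_mult_cancel:
  assumes "u \<in> range monomial" "u * p = u * q"
  shows "p = (q :: ('n, 'k::field) mpoly)"
proof (rule poly_mapping_eqI)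
  fix t
  obtain s where "u = monomial s" using assms by blast
  then show "Poly_Mapping.lookup p t = Poly_Mapping.lookup q t"
    using assms(2) by (metis lookup_monomial_mult)
qed

lemma is_min_mono_gens_antichain:
  assumes G: "is_min_mono_gens G I" and uv: "u \<in> G" "v \<in> G" "u dvd v"
  shows "u = (v :: ('n, 'k::field) mpoly)"
proof (rule ccontr)
  assume "u \<noteq> v"
  have range: "G \<subseteq> range monomial" and I: "ideal_gen G = I"
    using G by (auto simp: is_min_mono_gens_def)
  \<comment> \<open>Otherwise \<open>v\<close> would be a redundant generator.\<close>
  have "v \<in> ideal_gen (G - {v})"
  proof -
    obtain t where "v = monomial t" using uv range by blast
    moreover have "monomial t \<in> ideal_gen (G - {v})" if "v = monomial t" for t
      using uv range that \<open>u \<noteq> v\<close> by (subst monomial_in_ideal_gen_iff) auto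
    ultimately show ?thesis by blast
  qed
  then have "ideal_gen (G - {v}) = ideal_gen G"
    unfolding ideal_gen_def ideal.span_eq by (auto intro: ideal.span_base)
  then show False
    using G uv(2) unfolding is_min_mono_gens_def by blast
qed

lemma is_min_mono_gensI:
  fixes G :: "('n, 'k::field) mpoly set"
  assumes G: "G \<subseteq> range monomial" and anti: "\<And>u v. u \<in> G \<Longrightarrow> v \<in> G \<Longrightarrow> u dvd v \<Longrightarrow> u = v"
  shows "is_min_mono_gens G (ideal_gen G)"
  unfolding is_min_mono_gens_def
proof (intro conjI allI impI notI)
  fix H assume H: "H \<subset> G" "ideal_gen H = ideal_gen G"
  then obtain v where v: "v \<in> G" "v \<notin> H" by blast
  then obtain t where t: "v = monomial t" using G by blast
  have "monomial t \<in> ideal_gen H"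
    using v t H(2) by (simp add: ideal_gen_def ideal.span_base)
  moreover have "H \<subseteq> range monomial" using H(1) G by blast
  ultimately obtain h where "h \<in> H" "h dvd v"
    using monomial_in_ideal_gen_iff t by blast
  then show False using anti[of h v] v H(1) by blast
qed (use G in auto)

lemma min_mono_gens_eq:
  fixes I :: "('n::finite, 'k::field) mpoly set"
  assumes "is_min_mono_gens G I"
  shows "min_mono_gens I = G"
proof -
  have "monomial_ideal I"
    using assms by (auto simp: monomial_ideal_def is_min_mono_gens_def)
  from the1_equality[OF ex1_min_mono_gens[OF this] assms] show ?thesis
    by (simp add: min_mono_gens_def)
qed

text \<open>A minimal generator is a multiple of some element of \<open>M\<close>, which is in turn a multiple of a
  minimal generator. By minimality all three coincide.\<close>

lemma is_min_mono_gens_subset: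
  fixes M :: "('n, 'k::field) mpoly set"
  assumes G: "is_min_mono_gens G (ideal_gen M)" and M: "M \<subseteq> range monomial"
  shows "G \<subseteq> M"
proof
  fix g assume g: "g \<in> G"
  have range: "G \<subseteq> range monomial" and gen: "ideal_gen G = ideal_gen M"
    using G by (auto simp: is_min_mono_gens_def)
  obtain t where t: "g = monomial t" using g range by blast
  have "g \<in> ideal_gen M" using g gen ideal.span_base unfolding ideal_gen_def by blast
  then obtain m where m: "m \<in> M" "m dvd g"
    using monomial_in_ideal_gen_iff[OF M] t by blast
  obtain s where s: "m = monomial s" using m M by blast
  have "m \<in> ideal_gen G" using m gen ideal.span_base unfolding ideal_gen_def by blast
  then obtain h where h: "h \<in> G" "h dvd m"
    using monomial_in_ideal_gen_iff[OF range] s by blast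
  have "h = g"
    using is_min_mono_gens_antichain[OF G h(1) g] h(2) m(2) dvd_trans by blast
  then have "g = m" using h m s t by (intro monomial_dvd_antisym) auto
  then show "g \<in> M" using m by simp
qed

section \<open>Squarefree monomials as sets of variables\<close>

definition monom_of :: "'n set \<Rightarrow> ('n, 'k::field) mpoly" where
  "monom_of A = (\<Prod>i\<in>A. var i)"

lemma monom_of_eq_monomial:
  "(monom_of A :: ('n::finite, 'k::field) mpoly) = monomial (\<Sum>i\<in>A. Poly_Mapping.single i 1)"
  unfolding monom_of_def
proof (induction A rule: infinite_finite_induct)
  case (insert i A)
  then show ?case by (simp add: var_def monomial_def Poly_Mapping.mult_single)
qed (simp_all add: monomial_def)

lemma deg_var_monom_of:
  "deg_var i (monom_of A :: ('n::finite, 'k::field) mpoly) = of_bool (i \<in> A)"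
  by (simp add: monom_of_eq_monomial deg_var_monomial lookup_sum lookup_single when_def of_bool_def)

lemma monom_of_in_range [simp]: "(monom_of A :: ('n::finite, 'k::field) mpoly) \<in> range monomial"
  by (simp add: monom_of_eq_monomial)

lemma squarefree_monom_of: "squarefree_monomial (monom_of A :: ('n::finite, 'k::field) mpoly)"
  by (simp add: squarefree_monomial_def deg_var_monom_of)

lemma squarefree_monomialE:
  assumes "squarefree_monomial (u :: ('n::finite, 'k::field) mpoly)"
  obtains A where "u = monom_of A"
proof
  obtain t where t: "u = monomial t" using assms by (auto simp: squarefree_monomial_def)
  have "Poly_Mapping.lookup t i = of_bool (deg_var i u = 1)" for i
  proof -
    have "deg_var i u \<le> 1" using assms by (simp add: squarefree_monomial_def)
    then show ?thesis by (simp add: t deg_var_monomial of_bool_def)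
  qed
  then have "t = (\<Sum>i | deg_var i u = 1. Poly_Mapping.single i 1)"
    by (intro poly_mapping_eqI) (simp add: lookup_sum lookup_single when_def of_bool_def)
  then show "u = monom_of {i. deg_var i u = 1}"
    unfolding monom_of_eq_monomial t by simp
qed

lemma monom_of_dvd_iff [simp]:
  "(monom_of A :: ('n::finite, 'k::field) mpoly) dvd monom_of B \<longleftrightarrow> A \<subseteq> B"
  unfolding monom_of_eq_monomial monomial_dvd_monomial_iff
  by (auto simp: lookup_sum lookup_single when_def split: if_splits)

lemma monom_of_eq_iff [simp]:
  "(monom_of A :: ('n::finite, 'k::field) mpoly) = monom_of B \<longleftrightarrow> A = B"
  by (metis monom_of_dvd_iff order_antisym order_refl)

lemma mdegree_monom_of: "mdegree (monom_of A :: ('n::finite, 'k::field) mpoly) = card A"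
  by (simp add: mdegree_def deg_var_monom_of)

lemma var_mult_monom_of:
  assumes "i \<notin> A"
  shows "var i * monom_of A = (monom_of (insert i A) :: ('n::finite, 'k::field) mpoly)"
  using assms by (simp add: monom_of_def)

lemma monom_of_mult_eq_prod_var_iff:
  "monom_of A * w = (\<Prod>i\<in>UNIV. var i :: ('n::finite, 'k::field) mpoly) \<longleftrightarrow> w = monom_of (- A)"
proof -
  have *: "monom_of A * monom_of (- A) = (\<Prod>i\<in>UNIV. var i :: ('n, 'k) mpoly)"
    unfolding monom_of_def by (subst prod.union_disjoint[symmetric]) auto
  then show ?thesis
    using monomial_mult_cancel[of "monom_of A" w "monom_of (- A)"] by auto
qed

section \<open>Squarefree monomial ideals as antichains\<close>

definition antichain :: "'a set set \<Rightarrow> bool" where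
  "antichain F \<longleftrightarrow> (\<forall>A\<in>F. \<forall>B\<in>F. A \<subseteq> B \<longrightarrow> A = B)"

lemma antichain_complements: "antichain F \<Longrightarrow> antichain (uminus ` F)"
  by (auto simp: antichain_def)

definition ideal_of :: "'n set set \<Rightarrow> ('n, 'k::field) mpoly set" where
  "ideal_of F = ideal_gen (monom_of ` F)"

lemma min_mono_gens_ideal_of:
  assumes "antichain F"
  shows "min_mono_gens (ideal_of F :: ('n::finite, 'k::field) mpoly set) = monom_of ` F"
  unfolding ideal_of_def
  by (intro min_mono_gens_eq is_min_mono_gensI) (use assms in \<open>auto simp: antichain_def\<close>)

lemma squarefree_monomial_ideal_of:
  "squarefree_monomial_ideal (ideal_of F :: ('n::finite, 'k::field) mpoly set)"
  unfolding squarefree_monomial_ideal_def ideal_of_def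
  using squarefree_monom_of by blast

lemma squarefree_monomial_ideal_imp_monomial_ideal:
  "squarefree_monomial_ideal I \<Longrightarrow> monomial_ideal I"
  unfolding squarefree_monomial_ideal_def monomial_ideal_def squarefree_monomial_def by blast

lemma squarefree_monomial_idealE:
  fixes I :: "('n::finite, 'k::field) mpoly set"
  assumes "squarefree_monomial_ideal I"
  obtains F where "antichain F" "I = ideal_of F"
proof -
  obtain M where M: "M \<subseteq> Collect squarefree_monomial" "I = ideal_gen M"
    using assms by (auto simp: squarefree_monomial_ideal_def)
  obtain G where G: "is_min_mono_gens G I"
    using ex1_min_mono_gens squarefree_monomial_ideal_imp_monomial_ideal[OF assms] by blast
  have "G \<subseteq> M"
    using is_min_mono_gens_subset[of G M] G M unfolding squarefree_monomial_def by blast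
  then have "G \<subseteq> range monom_of"
    using M(1) by (blast elim: squarefree_monomialE)
  then obtain F where F: "G = monom_of ` F" by (auto simp: subset_image_iff)
  show thesis
  proof
    show "antichain F"
      using is_min_mono_gens_antichain[OF G] unfolding F antichain_def by fastforce
    show "I = ideal_of F"
      using G by (simp add: is_min_mono_gens_def ideal_of_def F)
  qed
qed

text \<open>The zero ideal is the ideal of the empty family, so the case distinction in
  \<^const>\<open>complementary_ideal\<close> disappears.\<close>

lemma complementary_ideal_ideal_of:
  assumes F: "antichain F"
  shows "complementary_ideal (ideal_of F :: ('n::finite, 'k::field) mpoly set) =
    ideal_of (uminus ` F)"
proof (cases "ideal_of F = ({0} :: ('n, 'k) mpoly set)")
  case True
  have "F = {}"
  proof (rule ccontr)
    assume "F \<noteq> {}"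
    then obtain A where "A \<in> F" by blast
    then have "(monom_of A :: ('n, 'k) mpoly) \<in> ideal_of F"
      by (simp add: ideal_of_def ideal_gen_def ideal.span_base)
    moreover have "(monom_of A :: ('n, 'k) mpoly) \<noteq> 0"
      by (metis monom_of_eq_monomial monomial_def lookup_single_eq lookup_zero zero_neq_one)
    ultimately show False using True by blast
  qed
  then show ?thesis
    by (simp add: complementary_ideal_def ideal_of_def ideal_gen_def)
next
  case False
  have "{w :: ('n, 'k) mpoly. \<exists>u\<in>monom_of ` F. u * w = (\<Prod>i\<in>UNIV. var i)} =
      monom_of ` uminus ` F"
    by (auto simp: monom_of_mult_eq_prod_var_iff)
  then show ?thesis
    using False
    by (simp only: complementary_ideal_def min_mono_gens_ideal_of[OF F] if_False
        ideal_of_def[of "uminus ` F"])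
qed

text \<open>A factorisation \<open>u = x\<^sub>i w\<close> determines \<open>w\<close>, so \<open>w\<close> is the monomial of the support with \<open>i\<close>
  removed.\<close>

lemma monom_of_exchange_iff:
  fixes F :: "'n::finite set set"
  assumes "i \<in> A" "j \<notin> A"
  shows "(\<exists>w. (monom_of A :: ('n, 'k::field) mpoly) = var i * w \<and> var j * w \<in> monom_of ` F) \<longleftrightarrow>
    insert j (A - {i}) \<in> F"
proof -
  have A: "monom_of A = (var i * monom_of (A - {i}) :: ('n, 'k) mpoly)"
    using assms by (simp add: var_mult_monom_of insert_absorb)
  have "w = monom_of (A - {i})" if "monom_of A = (var i * w :: ('n, 'k) mpoly)" for w
    using that A monomial_mult_cancel[of "var i" w "monom_of (A - {i})"] by (simp add: var_def)
  then have "(\<exists>w. (monom_of A :: ('n, 'k) mpoly) = var i * w \<and> var j * w \<in> monom_of ` F) \<longleftrightarrow>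
      (var j * monom_of (A - {i}) :: ('n, 'k) mpoly) \<in> monom_of ` F"
    using A by blast
  also have "\<dots> \<longleftrightarrow> insert j (A - {i}) \<in> F"
    using assms by (auto simp: var_mult_monom_of)
  finally show ?thesis .
qed

lemma matroidal_ideal_of_iff:
  assumes F: "antichain F"
  shows "matroidal (ideal_of F :: ('n::finite, 'k::field) mpoly set) \<longleftrightarrow> base_family F"
proof -
  have less: "deg_var i (monom_of B :: ('n, 'k) mpoly) < deg_var i (monom_of A :: ('n, 'k) mpoly) \<longleftrightarrow>
      i \<in> A - B" for A B i
    by (auto simp: deg_var_monom_of)
  have exchange: "(\<forall>i. deg_var i (monom_of B :: ('n, 'k) mpoly) < deg_var i (monom_of A :: ('n, 'k) mpoly) \<longrightarrow>
      (\<exists>j. deg_var j (monom_of A :: ('n, 'k) mpoly) < deg_var j (monom_of B :: ('n, 'k) mpoly) \<and>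
        (\<exists>w. (monom_of A :: ('n, 'k) mpoly) = var i * w \<and> var j * w \<in> monom_of ` F))) \<longleftrightarrow>
      (\<forall>i\<in>A - B. \<exists>j\<in>B - A. insert j (A - {i}) \<in> F)" for A B
    by (simp add: less Ball_def Bex_def monom_of_exchange_iff cong: conj_cong imp_cong)
  have "matroidal (ideal_of F :: ('n, 'k) mpoly set) \<longleftrightarrow>
      polymatroidal (ideal_of F :: ('n, 'k) mpoly set)"
    by (simp add: matroidal_def squarefree_monomial_ideal_of)
  also have "\<dots> \<longleftrightarrow> base_family F"
    unfolding polymatroidal_def base_family_def min_mono_gens_ideal_of[OF F]
    by (simp only: ball_simps mdegree_monom_of exchange simp_thms
        squarefree_monomial_ideal_imp_monomial_ideal[OF squarefree_monomial_ideal_of])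
  finally show ?thesis .
qed

theorem theorem1p3:
  fixes I :: "('n::finite, 'k::field) mpoly set"
  assumes "squarefree_monomial_ideal I"
  shows "matroidal I \<longleftrightarrow> matroidal (complementary_ideal I)"
proof -
  obtain F where F: "antichain F" and I: "I = ideal_of F"
    using squarefree_monomial_idealE[OF assms] .
  show ?thesis
    unfolding I complementary_ideal_ideal_of[OF F]
    by (simp add: matroidal_ideal_of_iff F antichain_complements base_family_complements_iff)
qed

end
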